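(* Let $\Gamma=\{1,2,3\}$ be equipped with the partial order $\preceq$ in which $1\preceq 3$ and $2\preceq 3$ but $1$ and $2$ are incomparable. Then the map $$(i,j,k)\mapsto\begin{pmatrix} k&-\infty&i\\ -\infty&-k&j\\ -\infty&-\infty&0\end{pmatrix}$$ is an embedding of semigroups of the free monogenic inverse monoid $\mathcal{I}$ into $\Gamma(\mathbb{FT})\subseteq UT_3(\mathbb{T})$.
   Context: The tropical semiring $\mathbb{T}$ is the set $\mathbb{R}\cup\{-\infty\}$ with operations $a\oplus b=\max(a,b)$ and $a\otimes b=a+b$, where $-\infty\oplus a=a$ and $-\infty\otimes a=-\infty$. $\Gamma(\mathbb{FT})$ is the semigroup of all $3\times 3$ matrices $A$ over $\mathbb{T}$ (rows and columns indexed by $\Gamma=\{1,2,3\}$) such that $A_{i,j}\neq-\infty$ if and only if $i\preceq j$, under the matrix multiplication induced by $\oplus$ and $\otimes$. $UT_3(\mathbb{T})$ is the monoid of all $3\times 3$ matrices over $\mathbb{T}$ with all entries below the main diagonal equal to $-\infty$, under the same multiplication. The free monogenic inverse monoid $\mathcal{I}$ (the free one-generated object in the category of inverse monoids) is identified with the set $\{(i,j,k)\in\mathbb{Z}^3\mid i,j\ge 0,\ -j\le k\le i\}$ with multiplication $$(i,j,k)(i',j',k')=(\max(i,i'+k),\ \max(j,j'-k),\ k+k').$$ *)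

theory Defs
  imports Jordan_Normal_Form.Matrix "HOL-Algebra.Group"
begin

text \<open>
  The tropical semiring on the reals with an added minus infinity. Addition is the maximum and
  multiplication is real addition; hence \<open>0\<close> of this type is minus infinity and \<open>1\<close> is the real
  number zero. Matrix multiplication on \<open>trop mat\<close> is then the tropical one.
\<close>

datatype trop = NegInf (\<open>-\<infinity>\<close>) | Fin real

instantiation trop :: comm_semiring_1
begin

definition zero_trop :: trop where "0 = -\<infinity>"

definition one_trop :: trop where "1 = Fin 0"

fun plus_trop :: "trop \<Rightarrow> trop \<Rightarrow> trop" where
  "-\<infinity> + b = b"
| "Fin x + -\<infinity> = Fin x"
| "Fin x + Fin y = Fin (max x y)"

fun times_trop :: "trop \<Rightarrow> trop \<Rightarrow> trop" where
  "-\<infinity> * b = -\<infinity>"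
| "Fin x * -\<infinity> = -\<infinity>"
| "Fin x * Fin y = Fin (x + y)"

instance
proof
  fix a b c :: trop
  show "a + b + c = a + (b + c)" by (cases a; cases b; cases c) (auto simp: max_def)
  show "a + b = b + a" by (cases a; cases b) (auto simp: max_def)
  show "0 + a = a" by (simp add: zero_trop_def)
  show "a * b * c = a * (b * c)" by (cases a; cases b; cases c) auto
  show "a * b = b * a" by (cases a; cases b) (auto simp: add.commute)
  show "1 * a = a" by (cases a) (auto simp: one_trop_def)
  show "(a + b) * c = a * c + b * c" by (cases a; cases b; cases c) (auto simp: max_def)
  show "0 * a = 0" by (simp add: zero_trop_def)
  show "a * 0 = 0" by (cases a) (auto simp: zero_trop_def)
  show "(0::trop) \<noteq> 1" by (simp add: zero_trop_def one_trop_def)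
qed

end

text \<open>The library's \<open>upper_triangular\<close> says that the entries below the diagonal are \<open>0\<close>, which is
  minus infinity here.\<close>

definition UT3 :: "trop mat monoid" where
  "UT3 = \<lparr>carrier = {A \<in> carrier_mat 3 3. upper_triangular A}, mult = (*), one = 1\<^sub>m 3\<rparr>"

text \<open>Rows and columns are labelled by 1, 2, 3, whereas library matrices are indexed from 0.\<close>

definition Gamma_FT :: "nat rel \<Rightarrow> trop mat set" where
  "Gamma_FT R = {A \<in> carrier_mat 3 3.
     \<forall>i\<in>{1..3}. \<forall>j\<in>{1..3}. A $$ (i - 1, j - 1) \<noteq> -\<infinity> \<longleftrightarrow> (i, j) \<in> R}"

text \<open>The standard realisation of the free inverse monoid on one generator: the generator is
  \<open>(1, 0, 1)\<close>, and the inverse of \<open>(i, j, k)\<close> is \<open>(i - k, j + k, - k)\<close>.\<close>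

definition free_monogenic_inverse_monoid :: "(int \<times> int \<times> int) monoid" (\<open>\<I>\<close>) where
  "\<I> = \<lparr>carrier = {(i, j, k). i \<ge> 0 \<and> j \<ge> 0 \<and> - j \<le> k \<and> k \<le> i},
        mult = (\<lambda>(i, j, k) (i', j', k'). (max i (i' + k), max j (j' - k), k + k')),
        one = (0, 0, 0)\<rparr>"

fun trop_rep :: "int \<times> int \<times> int \<Rightarrow> trop mat" where
  "trop_rep (i, j, k) = mat_of_rows_list 3
     [[Fin (of_int k), -\<infinity>, Fin (of_int i)],
      [-\<infinity>, Fin (- of_int k), Fin (of_int j)],
      [-\<infinity>, -\<infinity>, Fin 0]]"

lemma monoid_free_monogenic: "monoid \<I>"
  by unfold_locales (auto simp: free_monogenic_inverse_monoid_def)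

lemma free_monogenic_inverse:
  assumes "x \<in> carrier \<I>"
  shows "\<exists>!y. y \<in> carrier \<I> \<and> x \<otimes>\<^bsub>\<I>\<^esub> y \<otimes>\<^bsub>\<I>\<^esub> x = x \<and> y \<otimes>\<^bsub>\<I>\<^esub> x \<otimes>\<^bsub>\<I>\<^esub> y = y"
proof -
  obtain i j k where x: "x = (i, j, k)" by (cases x)
  show ?thesis
  proof (rule ex1I[of _ "(i - k, j + k, - k)"])
    show "(i - k, j + k, - k) \<in> carrier \<I> \<and>
        x \<otimes>\<^bsub>\<I>\<^esub> (i - k, j + k, - k) \<otimes>\<^bsub>\<I>\<^esub> x = x \<and>
        (i - k, j + k, - k) \<otimes>\<^bsub>\<I>\<^esub> x \<otimes>\<^bsub>\<I>\<^esub> (i - k, j + k, - k) = (i - k, j + k, - k)"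
      using assms by (auto simp: x free_monogenic_inverse_monoid_def)
  next
    fix y
    assume "y \<in> carrier \<I> \<and> x \<otimes>\<^bsub>\<I>\<^esub> y \<otimes>\<^bsub>\<I>\<^esub> x = x \<and> y \<otimes>\<^bsub>\<I>\<^esub> x \<otimes>\<^bsub>\<I>\<^esub> y = y"
    then show "y = (i - k, j + k, - k)"
      using assms by (cases y) (auto simp: x free_monogenic_inverse_monoid_def)
  qed
qed

lemma monoid_UT3: "monoid UT3"
proof
  fix A B assume "A \<in> carrier UT3" "B \<in> carrier UT3"
  then have A: "A \<in> carrier_mat 3 3" "upper_triangular A"
    and B: "B \<in> carrier_mat 3 3" "upper_triangular B"
    by (auto simp: UT3_def)
  have "(A * B) $$ (i, j) = 0" if "j < i" "i < 3" for i j
  proof -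
    have "A $$ (i, l) * B $$ (l, j) = 0" if "l < 3" for l
    proof (cases "l < i")
      case True
      then have "A $$ (i, l) = 0" using A \<open>i < 3\<close> by auto
      then show ?thesis by simp
    next
      case False
      then have "B $$ (l, j) = 0" using B \<open>j < i\<close> that by auto
      then show ?thesis by simp
    qed
    then show ?thesis using A B that by (auto simp: scalar_prod_def)
  qed
  then show "A \<otimes>\<^bsub>UT3\<^esub> B \<in> carrier UT3"
    using A B by (auto simp: UT3_def)
qed (auto simp: UT3_def assoc_mult_mat[of _ 3 3 _ 3 _ 3])

lemma Gamma_FT_mult_closed:
  assumes R: "partial_order_on {1..3} R" and "A \<in> Gamma_FT R" "B \<in> Gamma_FT R"
  shows "A * B \<in> Gamma_FT R"
proof -
  have add: "a + b = -\<infinity> \<longleftrightarrow> a = -\<infinity> \<and> b = -\<infinity>" for a b by (cases a; cases b) auto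
  have mult: "a * b = -\<infinity> \<longleftrightarrow> a = -\<infinity> \<or> b = -\<infinity>" for a b by (cases a; cases b) auto
  have sum: "sum f S = -\<infinity> \<longleftrightarrow> (\<forall>l\<in>S. f l = -\<infinity>)" if "finite S" for f and S :: "nat set"
    using that by induction (auto simp: add zero_trop_def)
  have A: "A \<in> carrier_mat 3 3" and B: "B \<in> carrier_mat 3 3"
    using assms by (auto simp: Gamma_FT_def)
  have Ai: "A $$ (i - 1, j - 1) \<noteq> -\<infinity> \<longleftrightarrow> (i, j) \<in> R"
    and Bi: "B $$ (i - 1, j - 1) \<noteq> -\<infinity> \<longleftrightarrow> (i, j) \<in> R"
    if "i \<in> {1..3}" "j \<in> {1..3}" for i j
    using assms that unfolding Gamma_FT_def by blast+
  have refl: "(i, i) \<in> R" if "i \<in> {1..3}" for i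
    using R that by (auto simp: partial_order_on_def preorder_on_def refl_on_def)
  have trans: "(i, j) \<in> R" if "(i, l) \<in> R" "(l, j) \<in> R" for i l j
    using R that by (auto simp: partial_order_on_def preorder_on_def dest: transD)
  have "(A * B) $$ (i - 1, j - 1) \<noteq> -\<infinity> \<longleftrightarrow> (i, j) \<in> R"
    if i: "i \<in> {1..3}" and j: "j \<in> {1..3}" for i j
  proof -
    have "(A * B) $$ (i - 1, j - 1) = (\<Sum>l\<in>{0..<3}. A $$ (i - 1, l) * B $$ (l, j - 1))"
      using A B i j by (auto simp: scalar_prod_def)
    also have "\<dots> = (\<Sum>l\<in>{1..3}. A $$ (i - 1, l - 1) * B $$ (l - 1, j - 1))"
      by (rule sum.reindex_bij_witness[of _ "\<lambda>l. l - 1" Suc]) auto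
    finally have "(A * B) $$ (i - 1, j - 1) \<noteq> -\<infinity> \<longleftrightarrow>
        (\<exists>l\<in>{1..3}. (i, l) \<in> R \<and> (l, j) \<in> R)"
      using Ai[OF i] Bi[OF _ j] by (simp add: sum mult)
    then show ?thesis using refl[OF i] trans i by blast
  qed
  then show ?thesis using A B by (auto simp: Gamma_FT_def)
qed

end

theory Submission
  imports Defs
begin

text \<open>In the tropical product of the images of \<open>(i, j, k)\<close> and
  \<open>(i', j', k')\<close>, the last column (max is the sum, + the product) has top entry
  \<open>max (k + i') (i + 0)\<close> and middle entry \<open>max (- k + j') (j + 0)\<close>, while
  the diagonal entries \<open>k\<close>, \<open>- k\<close>, 0 add up. This is exactly the
  multiplication of \<open>\<I>\<close> (\<open>trop_rep_mult\<close>). The triple can be read off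
  the matrix, so the map is injective (\<open>trop_rep_inject\<close>). The finite entries are the
  diagonal and the last column, which is the pattern of the order.\<close>

lemma trop_rep_index:
  "trop_rep (i, j, k) \<in> carrier_mat 3 3"
  "trop_rep (i, j, k) $$ (0, 0) = Fin (of_int k)"
  "trop_rep (i, j, k) $$ (0, 1) = -\<infinity>"
  "trop_rep (i, j, k) $$ (0, 2) = Fin (of_int i)"
  "trop_rep (i, j, k) $$ (1, 0) = -\<infinity>"
  "trop_rep (i, j, k) $$ (1, 1) = Fin (- of_int k)"
  "trop_rep (i, j, k) $$ (1, 2) = Fin (of_int j)"
  "trop_rep (i, j, k) $$ (2, 0) = -\<infinity>"
  "trop_rep (i, j, k) $$ (2, 1) = -\<infinity>"
  "trop_rep (i, j, k) $$ (2, 2) = Fin 0"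
  by (auto simp: mat_of_rows_list_def)

lemma eq_mat_3I:
  assumes "A \<in> carrier_mat 3 3" "B \<in> carrier_mat 3 3"
    and "\<And>i j. i \<in> {0, 1, 2} \<Longrightarrow> j \<in> {0, 1, 2} \<Longrightarrow> A $$ (i, j) = B $$ (i, j)"
  shows "A = B"
proof (rule eq_matI)
  fix i j assume "i < dim_row B" "j < dim_col B"
  with assms(2) have "i \<in> {0, 1, 2}" "j \<in> {0, 1, 2}" by auto
  then show "A $$ (i, j) = B $$ (i, j)" by (rule assms(3))
qed (use assms in auto)

lemma mult_mat_3_index:
  fixes A B :: "'a::semiring_0 mat"
  assumes "A \<in> carrier_mat 3 3" "B \<in> carrier_mat 3 3" "i \<in> {0, 1, 2}" "j \<in> {0, 1, 2}"
  shows "(A * B) $$ (i, j) =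
    A $$ (i, 0) * B $$ (0, j) + A $$ (i, 1) * B $$ (1, j) + A $$ (i, 2) * B $$ (2, j)"
proof -
  have "i < 3" "j < 3" using assms by auto
  then show ?thesis using assms(1,2)
    by (simp add: scalar_prod_def eval_nat_numeral)
qed

lemma trop_rep_mult:
  "trop_rep (i, j, k) * trop_rep (i', j', k') =
    trop_rep (max i (i' + k), max j (j' - k), k + k')"
    (is "?A * ?B = ?C")
proof (rule eq_mat_3I)
  fix r s :: nat
  assume rs: "r \<in> {0, 1, 2}" "s \<in> {0, 1, 2}"
  show "(?A * ?B) $$ (r, s) = ?C $$ (r, s)"
    unfolding mult_mat_3_index[OF trop_rep_index(1) trop_rep_index(1) rs]
    \<comment> \<open>Simplification turns the index 1 into \<open>Suc 0\<close>, so the entry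
      equations are put in that form. What remains are nine identities about maxima and
      sums.\<close>
    using rs by (auto simp: trop_rep_index[unfolded One_nat_def] max_def simp del: trop_rep.simps)
qed (use trop_rep_index(1) in \<open>blast intro: mult_carrier_mat\<close>)+

text \<open>The entries at (0, 0), (0, 2) and (1, 2) are \<open>k\<close>, \<open>i\<close> and
  \<open>j\<close>, and integers embed injectively in the reals.\<close>

lemma trop_rep_inject: "trop_rep x = trop_rep y \<longleftrightarrow> x = y"
proof
  assume eq: "trop_rep x = trop_rep y"
  obtain i j k i' j' k' where xy: "x = (i, j, k)" "y = (i', j', k')"
    by (cases x, cases y)
  have "trop_rep x $$ (0, 0) = trop_rep y $$ (0, 0)"
    "trop_rep x $$ (0, 2) = trop_rep y $$ (0, 2)"
    "trop_rep x $$ (1, 2) = trop_rep y $$ (1, 2)"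
    using eq by simp_all
  then show "x = y" unfolding xy trop_rep_index by simp
qed simp

text \<open>If no label is related to a smaller one, every position below the diagonal must hold
  minus infinity, the zero of \<open>trop\<close>.\<close>

lemma Gamma_FT_subset_UT3:
  assumes "\<And>i j. 1 \<le> j \<Longrightarrow> j < i \<Longrightarrow> i \<le> 3 \<Longrightarrow> (i, j) \<notin> R"
  shows "Gamma_FT R \<subseteq> carrier UT3"
proof
  fix A assume A: "A \<in> Gamma_FT R"
  have "A $$ (i, j) = 0" if "j < i" "i < 3" for i j
  proof -
    \<comment> \<open>The matrix index \<open>i\<close> carries the label
      \<open>Suc i\<close>.\<close>
    have "Suc i \<in> {1..3}" "Suc j \<in> {1..3}" using that by auto
    then have "A $$ (Suc i - 1, Suc j - 1) \<noteq> -\<infinity> \<longleftrightarrow> (Suc i, Suc j) \<in> R"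
      using A unfolding Gamma_FT_def by blast
    then show ?thesis using assms[of "Suc j" "Suc i"] that by (simp add: zero_trop_def)
  qed
  then show "A \<in> carrier UT3" using A by (auto simp: Gamma_FT_def UT3_def)
qed

theorem mainTheorem7:
  fixes R :: "nat rel"
  assumes "partial_order_on {1..3} R"
    and "(1, 3) \<in> R" and "(2, 3) \<in> R"
    and "(1, 2) \<notin> R" and "(2, 1) \<notin> R"
  shows "Gamma_FT R \<subseteq> carrier UT3 \<and>
    trop_rep \<in> mon \<I> (UT3\<lparr>carrier := Gamma_FT R\<rparr>)"
proof -
  have refl: "(1, 1) \<in> R" "(2, 2) \<in> R" "(3, 3) \<in> R"
    using assms(1) by (auto simp: partial_order_on_def preorder_on_def refl_on_def)
  have antisym: "(3, 1) \<notin> R" "(3, 2) \<notin> R"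
    using assms(1-3) by (auto simp: partial_order_on_def dest: antisymD)
  \<comment> \<open>These facts decide \<open>R\<close> on all nine pairs of labels.\<close>
  note R_iff = refl antisym assms(2-5)
  have set3: "{1..3} = {1, 2, 3::nat}" by auto
  have "Gamma_FT R \<subseteq> carrier UT3"
  proof (rule Gamma_FT_subset_UT3)
    fix i j :: nat
    assume "1 \<le> j" "j < i" "i \<le> 3"
    then have "(i, j) \<in> {(2, 1), (3, 1), (3, 2)}" by auto
    then show "(i, j) \<notin> R" using R_iff by auto
  qed
  moreover have "trop_rep x \<in> Gamma_FT R" for x
  proof -
    obtain i j k where x: "x = (i, j, k)" by (cases x)
    show ?thesis
      unfolding x Gamma_FT_def set3 using R_iff trop_rep_index[of i j k]
      by (simp del: trop_rep.simps)
  qed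
  moreover have "trop_rep (x \<otimes>\<^bsub>\<I>\<^esub> y) = trop_rep x * trop_rep y" for x y
    by (cases x, cases y)
      (simp add: free_monogenic_inverse_monoid_def trop_rep_mult del: trop_rep.simps)
  \<comment> \<open>Membership in \<open>mon\<close> concerns only carriers, multiplication and
    injectivity, not the units, so it expresses an embedding of semigroups. This matters because the
    unit \<open>1\<^sub>m 3\<close> of \<open>UT3\<close> lies outside \<open>Gamma_FT R\<close>:
    its (1, 3) entry is minus infinity.\<close>
  ultimately show ?thesis
    by (auto simp: mon_def hom_def UT3_def inj_on_def trop_rep_inject simp del: trop_rep.simps)
qed

end
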